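(* Assume that the mean random dynamical system $\Phi$ on $L^p(\Omega,\mathcal{F};X)$ over $(\Omega,\mathcal{F},\{\mathcal{F}_t\}_{t\in\mathbb{R}},P)$ possesses an invariant weak $\mathcal{D}$-pullback mean random attractor $\mathcal{A}\in\mathcal{D}$ which is bounded, i.e. $\bigcup_{t\in\mathbb{R}}\mathcal{A}(t)$ is bounded. Then for every $t\in\mathbb{R}$ $$\mathcal{A}(t)=\{\phi(t):\phi\in\mathcal{D}\text{ is a bounded complete trajectory}\}.$$ If, moreover, $\mathcal{D}$ contains any bounded family, then for every $t\in\mathbb{R}$ $$\mathcal{A}(t)=\{\phi(t):\phi\text{ is a bounded complete trajectory}\}.$$
   Context: $X$ is a Banach space, $p\in(1,\infty)$, and $(\Omega,\mathcal{F},\{\mathcal{F}_t\}_{t\in\mathbb{R}},P)$ is a complete filtered probability space, $\{\mathcal{F}_t\}_{t\in\mathbb{R}}$ being an increasing right continuous family of sub-$\sigma$-algebras of $\mathcal{F}$ containing all $P$-null sets. $L^p(\Omega,\mathcal{F};X)$ is the Banach space of Bochner integrable $y:\Omega\to X$ with $\int_\Omega\|y\|_X^p\,dP<\infty$, and $L^p(\Omega,\mathcal{F}_t;X)$ its subspace of strongly $\mathcal{F}_t$-measurable elements. $\mathcal{D}$ is a given collection of families $D=\{D(t)\}_{t\in\mathbb{R}}$ of non-empty bounded sets $D(t)\subset L^p(\Omega,\mathcal{F}_t;X)$. A mean random dynamical system on $L^p(\Omega,\mathcal{F};X)$ over this filtered space is a family of maps $\Phi(t,\tau):L^p(\Omega,\mathcal{F}_\tau;X)\to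 L^p(\Omega,\mathcal{F}_{t+\tau};X)$, $t\ge0$, $\tau\in\mathbb{R}$, with $\Phi(0,\tau)=\mathrm{id}$ and $\Phi(t+s,\tau)=\Phi(t,s+\tau)\circ\Phi(s,\tau)$ for $t,s\ge0$, $\tau\in\mathbb{R}$. $K\in\mathcal{D}$ is $\mathcal{D}$-pullback weakly attracting if for all $\tau\in\mathbb{R}$, $D\in\mathcal{D}$ and any weak neighborhood $\mathcal{N}^w(K(\tau))$ of $K(\tau)$ in $L^p(\Omega,\mathcal{F}_\tau;X)$ there is $T>0$ with $\Phi(t,\tau-t)D(\tau-t)\subset\mathcal{N}^w(K(\tau))$ for all $t\ge T$. $\mathcal{A}\in\mathcal{D}$ is a weak $\mathcal{D}$-pullback mean random attractor if (1) $\mathcal{A}(\tau)$ is weakly compact in $L^p(\Omega,\mathcal{F}_\tau;X)$ for all $\tau\in\mathbb{R}$; (2) $\mathcal{A}$ is $\mathcal{D}$-pullback weakly attracting; (3) if $B\in\mathcal{D}$ satisfies (1) and (2), then $\mathcal{A}(t)\subset B(t)$ for all $t\in\mathbb{R}$. It is invariant if $\mathcal{A}(t)=\Phi(\tau,t-\tau)\mathcal{A}(t-\tau)$ for all $\tau\ge0$, $t\in\mathbb{R}$. A map $\phi$ with $\phi(t)\in L^p(\Omega,\mathcal{F}_t;X)$ for all $t\in\mathbb{R}$ is a complete trajectory if $\phi(t)=\Phi(t-s,s)\phi(s)$ for all $s<t$; it is identified with the family of singletons $\{\{\phi(t)\}\}_{t\in\mathbb{R}}$, and $\phi\in\mathcal{D}$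 means that this family belongs to $\mathcal{D}$. In this statement a family $D=\{D(t)\}_{t\in\mathbb{R}}$ of non-empty bounded sets $D(t)\subset L^p(\Omega,\mathcal{F}_t;X)$ is called bounded if $\bigcup_{t\in\mathbb{R}}D(t)$ is bounded.
   Formalization: The inclusion of A(t) in the right-hand side of the first equality is proved only when 𝒟 is inclusion-closed (non-empty subfamilies of members are members); for arbitrary 𝒟 it fails, e.g. X=ℝ, one-point Ω, Φ=id, 𝒟={A}, A(t)={0,1}. *)

theory Defs
  imports "HOL-Probability.Probability"
begin

text \<open>The index of the filtration is a family of measures \<open>F t\<close> of which only the space and the
  \<open>\<sigma>\<close>-algebra matter; the probability is always the one carried by \<open>M\<close>.\<close>

locale complete_filtered_prob_space =
  prob_space M + complete_measure M + filtration "space M" F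
  for M :: "'w measure" and F :: "real \<Rightarrow> 'w measure" +
  assumes sets_F_subset: "sets (F t) \<subseteq> sets M"
    and right_continuous: "sets (F t) = (\<Inter>s\<in>{t<..}. sets (F s))"
    and null_sets_F: "null_sets M \<subseteq> sets (F t)"

text \<open>The library's Bochner integral is restricted to second countable spaces, so strong
  measurability and integrability are introduced here for values in an arbitrary Banach space.\<close>

definition strongly_measurable :: "'w measure \<Rightarrow> ('w \<Rightarrow> 'x::real_normed_vector) \<Rightarrow> bool" where
  "strongly_measurable N f \<longleftrightarrow>
    (\<exists>s :: nat \<Rightarrow> 'w \<Rightarrow> 'x. (\<forall>i. simple_function N (s i)) \<and>
      (\<forall>w\<in>space N. (\<lambda>i. s i w) \<longlonglongrightarrow> f w))"

definition bochner_integrable :: "'w measure \<Rightarrow> ('w \<Rightarrow> 'x::real_normed_vector) \<Rightarrow> bool" where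
  "bochner_integrable M f \<longleftrightarrow> strongly_measurable M f \<and> integrable M (\<lambda>w. norm (f w))"

definition Lp_fun :: "real \<Rightarrow> 'w measure \<Rightarrow> 'w measure \<Rightarrow> ('w \<Rightarrow> 'x::real_normed_vector) set" where
  "Lp_fun p M N = {f. bochner_integrable M f \<and> integrable M (\<lambda>w. norm (f w) powr p) \<and>
    strongly_measurable N f}"

text \<open>Elements of \<open>L\<^sup>p\<close> are classes of functions modulo equality \<open>M\<close>-almost everywhere. The classes
  are formed among all \<open>M\<close>-measurable functions, so that \<open>Lp p M N\<close>, the set of classes having
  an \<open>N\<close>-measurable member, is literally a subset of \<open>Lp p M M\<close>, which is the whole space
  \<open>L\<^sup>p\<close> over \<open>M\<close>.\<close>

definition Lp_class :: "real \<Rightarrow> 'w measure \<Rightarrow> ('w \<Rightarrow> 'x::real_normed_vector) \<Rightarrow> ('w \<Rightarrow> 'x) set" where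
  "Lp_class p M f = {g \<in> Lp_fun p M M. AE w in M. g w = f w}"

definition Lp :: "real \<Rightarrow> 'w measure \<Rightarrow> 'w measure \<Rightarrow> ('w \<Rightarrow> 'x::real_normed_vector) set set" where
  "Lp p M N = Lp_class p M ` Lp_fun p M N"

definition Lp_norm :: "real \<Rightarrow> 'w measure \<Rightarrow> ('w \<Rightarrow> 'x::real_normed_vector) set \<Rightarrow> real" where
  "Lp_norm p M u = (\<integral>w. norm ((SOME f. f \<in> u) w) powr p \<partial>M) powr (1 / p)"

definition Lp_bounded :: "real \<Rightarrow> 'w measure \<Rightarrow> ('w \<Rightarrow> 'x::real_normed_vector) set set \<Rightarrow> bool" where
  "Lp_bounded p M S \<longleftrightarrow> (\<exists>C. \<forall>u\<in>S. Lp_norm p M u \<le> C)"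

text \<open>Bounded real-linear functionals on \<open>Lp p M N\<close>; their values outside \<open>Lp p M N\<close> are arbitrary.\<close>

definition Lp_dual ::
    "real \<Rightarrow> 'w measure \<Rightarrow> 'w measure \<Rightarrow> (('w \<Rightarrow> 'x::real_normed_vector) set \<Rightarrow> real) set" where
  "Lp_dual p M N = {L.
    (\<forall>f\<in>Lp_fun p M N. \<forall>g\<in>Lp_fun p M N.
      L (Lp_class p M (\<lambda>w. f w + g w)) = L (Lp_class p M f) + L (Lp_class p M g)) \<and>
    (\<forall>c. \<forall>f\<in>Lp_fun p M N. L (Lp_class p M (\<lambda>w. c *\<^sub>R f w)) = c * L (Lp_class p M f)) \<and>
    (\<exists>C. \<forall>u\<in>Lp p M N. \<bar>L u\<bar> \<le> C * Lp_norm p M u)}"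

definition weak_topology ::
    "real \<Rightarrow> 'w measure \<Rightarrow> 'w measure \<Rightarrow> ('w \<Rightarrow> 'x::real_normed_vector) set topology" where
  "weak_topology p M N =
    topology_generated_by {{u \<in> Lp p M N. L u \<in> U} | L U. L \<in> Lp_dual p M N \<and> open U}"

definition weak_neighborhood ::
    "real \<Rightarrow> 'w measure \<Rightarrow> 'w measure \<Rightarrow> ('w \<Rightarrow> 'x::real_normed_vector) set set
      \<Rightarrow> ('w \<Rightarrow> 'x) set set \<Rightarrow> bool" where
  "weak_neighborhood p M N K V \<longleftrightarrow>
    V \<subseteq> Lp p M N \<and> (\<exists>U. openin (weak_topology p M N) U \<and> K \<subseteq> U \<and> U \<subseteq> V)"

type_synonym ('w, 'x) Lp_family = "real \<Rightarrow> ('w \<Rightarrow> 'x) set set"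

definition Lp_family ::
    "real \<Rightarrow> 'w measure \<Rightarrow> (real \<Rightarrow> 'w measure) \<Rightarrow> ('w, 'x::real_normed_vector) Lp_family \<Rightarrow> bool" where
  "Lp_family p M F D \<longleftrightarrow> (\<forall>t. D t \<noteq> {} \<and> D t \<subseteq> Lp p M (F t) \<and> Lp_bounded p M (D t))"

definition bounded_family ::
    "real \<Rightarrow> 'w measure \<Rightarrow> (real \<Rightarrow> 'w measure) \<Rightarrow> ('w, 'x::real_normed_vector) Lp_family \<Rightarrow> bool" where
  "bounded_family p M F D \<longleftrightarrow> Lp_family p M F D \<and> Lp_bounded p M (\<Union>t. D t)"

definition inclusion_closed :: "('w, 'x) Lp_family set \<Rightarrow> bool" where
  "inclusion_closed \<D> \<longleftrightarrow> (\<forall>D\<in>\<D>. \<forall>D'. (\<forall>t. D' t \<noteq> {} \<and> D' t \<subseteq> D t) \<longrightarrow> D' \<in> \<D>)"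

definition mean_rds ::
    "real \<Rightarrow> 'w measure \<Rightarrow> (real \<Rightarrow> 'w measure)
      \<Rightarrow> (real \<Rightarrow> real \<Rightarrow> ('w \<Rightarrow> 'x::real_normed_vector) set \<Rightarrow> ('w \<Rightarrow> 'x) set) \<Rightarrow> bool" where
  "mean_rds p M F \<Phi> \<longleftrightarrow>
    (\<forall>t\<ge>0. \<forall>\<tau>. \<forall>u\<in>Lp p M (F \<tau>). \<Phi> t \<tau> u \<in> Lp p M (F (t + \<tau>))) \<and>
    (\<forall>\<tau>. \<forall>u\<in>Lp p M (F \<tau>). \<Phi> 0 \<tau> u = u) \<and>
    (\<forall>t\<ge>0. \<forall>s\<ge>0. \<forall>\<tau>. \<forall>u\<in>Lp p M (F \<tau>). \<Phi> (t + s) \<tau> u = \<Phi> t (s + \<tau>) (\<Phi> s \<tau> u))"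

definition pullback_weakly_attracting ::
    "real \<Rightarrow> 'w measure \<Rightarrow> (real \<Rightarrow> 'w measure)
      \<Rightarrow> (real \<Rightarrow> real \<Rightarrow> ('w \<Rightarrow> 'x::real_normed_vector) set \<Rightarrow> ('w \<Rightarrow> 'x) set)
      \<Rightarrow> ('w, 'x) Lp_family set \<Rightarrow> ('w, 'x) Lp_family \<Rightarrow> bool" where
  "pullback_weakly_attracting p M F \<Phi> \<D> K \<longleftrightarrow>
    (\<forall>\<tau>. \<forall>D\<in>\<D>. \<forall>V. weak_neighborhood p M (F \<tau>) (K \<tau>) V \<longrightarrow>
      (\<exists>T>0. \<forall>t\<ge>T. \<Phi> t (\<tau> - t) ` D (\<tau> - t) \<subseteq> V))"

definition weakly_compact_family ::
    "real \<Rightarrow> 'w measure \<Rightarrow> (real \<Rightarrow> 'w measure) \<Rightarrow> ('w, 'x::real_normed_vector) Lp_family \<Rightarrow> bool" where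
  "weakly_compact_family p M F K \<longleftrightarrow> (\<forall>\<tau>. compactin (weak_topology p M (F \<tau>)) (K \<tau>))"

definition weak_pullback_mean_random_attractor ::
    "real \<Rightarrow> 'w measure \<Rightarrow> (real \<Rightarrow> 'w measure)
      \<Rightarrow> (real \<Rightarrow> real \<Rightarrow> ('w \<Rightarrow> 'x::real_normed_vector) set \<Rightarrow> ('w \<Rightarrow> 'x) set)
      \<Rightarrow> ('w, 'x) Lp_family set \<Rightarrow> ('w, 'x) Lp_family \<Rightarrow> bool" where
  "weak_pullback_mean_random_attractor p M F \<Phi> \<D> A \<longleftrightarrow>
    A \<in> \<D> \<and>
    weakly_compact_family p M F A \<and>
    pullback_weakly_attracting p M F \<Phi> \<D> A \<and>
    (\<forall>B\<in>\<D>. weakly_compact_family p M F B \<longrightarrow> pullback_weakly_attracting p M F \<Phi> \<D> B \<longrightarrow>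
      (\<forall>t. A t \<subseteq> B t))"

definition invariant_family ::
    "(real \<Rightarrow> real \<Rightarrow> ('w \<Rightarrow> 'x) set \<Rightarrow> ('w \<Rightarrow> 'x) set) \<Rightarrow> ('w, 'x) Lp_family \<Rightarrow> bool" where
  "invariant_family \<Phi> A \<longleftrightarrow> (\<forall>\<tau>\<ge>0. \<forall>t. A t = \<Phi> \<tau> (t - \<tau>) ` A (t - \<tau>))"

definition complete_trajectory ::
    "real \<Rightarrow> 'w measure \<Rightarrow> (real \<Rightarrow> 'w measure)
      \<Rightarrow> (real \<Rightarrow> real \<Rightarrow> ('w \<Rightarrow> 'x::real_normed_vector) set \<Rightarrow> ('w \<Rightarrow> 'x) set)
      \<Rightarrow> (real \<Rightarrow> ('w \<Rightarrow> 'x) set) \<Rightarrow> bool" where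
  "complete_trajectory p M F \<Phi> \<phi> \<longleftrightarrow>
    (\<forall>t. \<phi> t \<in> Lp p M (F t)) \<and> (\<forall>s t. s < t \<longrightarrow> \<phi> t = \<Phi> (t - s) s (\<phi> s))"

end

theory Submission
  imports Defs "HOL-Library.Function_Algebras"
begin

text \<open>Hahn-Banach on \<open>L\<^sup>p\<close> makes the weak topology \<open>T\<^sub>1\<close>, so \<open>L\<^sup>p - {\<phi>(t)}\<close> is a weak neighbourhood of
  \<open>A(t)\<close> as soon as \<open>\<phi>(t) \<notin> A(t)\<close>. Pulling back the family \<open>{\<phi>(s)}\<close> from time \<open>t - T\<close> gives
  \<open>\<phi>(t)\<close> again, which therefore cannot avoid \<open>A(t)\<close>. Conversely, invariance yields a backward orbit
  in \<open>A\<close> through each point at the times \<open>t - n\<close>, and the forward dynamics fills in the times between.\<close>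

section \<open>Hahn-Banach for a sublinear functional on a subspace\<close>

text \<open>The scalar action is a parameter so that functions with pointwise scaling can be plugged
  in, and the carrier \<open>V\<close> is a subset because \<open>Lp_fun p M N\<close> is only part
  of its function type.\<close>

locale real_subspace = vector_space scale
  for scale :: "real \<Rightarrow> 'b::ab_group_add \<Rightarrow> 'b" (infixr \<open>\<odot>\<close> 75) +
  fixes V :: "'b set"
  assumes subspace_V: "subspace V"
begin

lemmas V_closed = subspace_0[OF subspace_V] subspace_add[OF subspace_V]
  subspace_scale[OF subspace_V] subspace_neg[OF subspace_V] subspace_diff[OF subspace_V]

definition sublinear :: "('b \<Rightarrow> real) \<Rightarrow> bool" where
  "sublinear q \<longleftrightarrow> (\<forall>x\<in>V. \<forall>y\<in>V. q (x + y) \<le> q x + q y) \<and> (\<forall>c>0. \<forall>x\<in>V. q (c \<odot> x) \<le> c * q x)"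

lemma sublinear_add: "sublinear q \<Longrightarrow> x \<in> V \<Longrightarrow> y \<in> V \<Longrightarrow> q (x + y) \<le> q x + q y"
  by (simp add: sublinear_def)

text \<open>The reverse inequality is the homogeneity bound for \<open>1 / c\<close> at the point
  \<open>c \<odot> x\<close>.\<close>

lemma sublinear_scale:
  assumes q: "sublinear q" and "0 < c" and x: "x \<in> V"
  shows "q (c \<odot> x) = c * q x"
proof (rule antisym)
  show "q (c \<odot> x) \<le> c * q x"
    using assms by (simp add: sublinear_def)
  have "q ((1 / c) \<odot> (c \<odot> x)) \<le> (1 / c) * q (c \<odot> x)"
    using assms by (auto simp only: sublinear_def V_closed zero_less_divide_1_iff)
  then show "c * q x \<le> q (c \<odot> x)"
    using \<open>0 < c\<close> by (simp add: field_simps)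
qed

text \<open>Scaling by \<open>2\<close> fixes \<open>0\<close>, so
  \<open>q 0 = 2 * q 0\<close>.\<close>

lemma sublinear_zero: "sublinear q \<Longrightarrow> q 0 = 0"
  using sublinear_scale[of q 2 0] V_closed(1) by simp

lemma sublinear_lower: "sublinear q \<Longrightarrow> x \<in> V \<Longrightarrow> - q (- x) \<le> q x"
  using sublinear_add[of q x "- x"] sublinear_zero[of q] V_closed(4)[of x] by simp

text \<open>A minimal sublinear functional equals each of its \<open>lowering\<close>s; this is what makes it additive.\<close>

definition lowering :: "('b \<Rightarrow> real) \<Rightarrow> 'b \<Rightarrow> 'b \<Rightarrow> real" where
  "lowering q y x = (INF t\<in>{0..}. q (x + t \<odot> y) - t * q y)"

text \<open>The infimum is over a set bounded below by \<open>- q (- x)\<close>: subadditivity on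
  \<open>(x + s \<odot> y) + (- x)\<close> gives
  \<open>s * q y \<le> q (x + s \<odot> y) + q (- x)\<close>. The value \<open>s = 0\<close> is
  treated apart because homogeneity is only available for positive scalars.\<close>

lemma lowering_le:
  assumes q: "sublinear q" and x: "x \<in> V" and y: "y \<in> V" and t: "0 \<le> t"
  shows "lowering q y x \<le> q (x + t \<odot> y) - t * q y"
  unfolding lowering_def
proof (rule cINF_lower)
  show "bdd_below ((\<lambda>t. q (x + t \<odot> y) - t * q y) ` {0..})"
  proof (rule bdd_belowI2)
    fix s :: real
    assume "s \<in> {0..}"
    then have "q (s \<odot> y) = s * q y"
      using sublinear_scale[OF q _ y, of s] sublinear_zero[OF q] by (cases "s = 0") auto
    moreover have "q ((x + s \<odot> y) + (- x)) \<le> q (x + s \<odot> y) + q (- x)"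
      by (rule sublinear_add[OF q]) (intro V_closed x y)+
    ultimately show "- q (- x) \<le> q (x + s \<odot> y) - s * q y"
      by simp
  qed
qed (use t in simp)

text \<open>For subadditivity, parameters \<open>t\<close> and \<open>t'\<close> of the two infima
  combine to the parameter \<open>t + t'\<close> for \<open>x + x'\<close>; the infima are then
  taken one after the other. For homogeneity, the parameter \<open>t\<close> at \<open>x\<close>
  corresponds to \<open>c * t\<close> at \<open>c \<odot> x\<close>.\<close>

lemma sublinear_lowering:
  assumes q: "sublinear q" and y: "y \<in> V"
  shows "sublinear (lowering q y)"
  unfolding sublinear_def
proof (intro conjI ballI allI impI)
  fix x x' assume x: "x \<in> V" and x': "x' \<in> V"
  have "lowering q y (x + x') - (q (x' + t' \<odot> y) - t' * q y) \<le> q (x + t \<odot> y) - t * q y"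
    if t: "0 \<le> t" and t': "0 \<le> t'" for t t'
  proof -
    have "lowering q y (x + x') \<le> q ((x + x') + (t + t') \<odot> y) - (t + t') * q y"
      by (rule lowering_le[OF q _ y]) (use x x' t t' V_closed in auto)
    also have "(x + x') + (t + t') \<odot> y = (x + t \<odot> y) + (x' + t' \<odot> y)"
      by (simp add: scale_left_distrib algebra_simps)
    also have "q \<dots> \<le> q (x + t \<odot> y) + q (x' + t' \<odot> y)"
      by (rule sublinear_add[OF q]) (intro V_closed x x' y)+
    finally show ?thesis
      by (simp add: algebra_simps)
  qed
  then have "lowering q y (x + x') - (q (x' + t' \<odot> y) - t' * q y) \<le> lowering q y x"
    if "0 \<le> t'" for t'
    unfolding lowering_def[of q y x] using that by (intro cINF_greatest) auto
  then have "lowering q y (x + x') - lowering q y x \<le> q (x' + t' \<odot> y) - t' * q y"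
    if "0 \<le> t'" for t'
    using that by (simp add: algebra_simps)
  then have "lowering q y (x + x') - lowering q y x \<le> lowering q y x'"
    unfolding lowering_def[of q y x'] by (intro cINF_greatest) auto
  then show "lowering q y (x + x') \<le> lowering q y x + lowering q y x'"
    by simp
next
  fix c :: real and x assume c: "0 < c" and x: "x \<in> V"
  have "lowering q y (c \<odot> x) / c \<le> q (x + t \<odot> y) - t * q y" if t: "0 \<le> t" for t
  proof -
    have "lowering q y (c \<odot> x) \<le> q (c \<odot> x + (c * t) \<odot> y) - (c * t) * q y"
      by (rule lowering_le[OF q _ y]) (use x t c V_closed in auto)
    also have "c \<odot> x + (c * t) \<odot> y = c \<odot> (x + t \<odot> y)"
      by (simp add: scale_right_distrib)
    also have "q \<dots> = c * q (x + t \<odot> y)"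
      by (rule sublinear_scale[OF q c]) (intro V_closed x y)
    finally show ?thesis
      using c by (simp add: field_simps)
  qed
  then have "lowering q y (c \<odot> x) / c \<le> lowering q y x"
    unfolding lowering_def[of q y x] by (intro cINF_greatest) auto
  then show "lowering q y (c \<odot> x) \<le> c * lowering q y x"
    using c by (simp add: field_simps)
qed

text \<open>Zorn's lemma for the reversed pointwise order: a chain is bounded by its pointwise
  infimum, which is again sublinear and stays finite because every member is at least
  \<open>- q (- x)\<close> at \<open>x\<close>.\<close>

lemma exists_minimal_sublinear:
  assumes q: "sublinear q"
  obtains m where "sublinear m" "\<And>x. x \<in> V \<Longrightarrow> m x \<le> q x"
    "\<And>r x. sublinear r \<Longrightarrow> (\<And>y. y \<in> V \<Longrightarrow> r y \<le> m y) \<Longrightarrow> x \<in> V \<Longrightarrow> r x = m x"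
proof -
  \<comment> \<open>Fixing the value \<open>0\<close> off \<open>V\<close> makes comparison of
    functions the same as comparison on \<open>V\<close>, so that minimality in \<open>S\<close>
    says something about \<open>V\<close> only.\<close>
  define S where "S = {r. sublinear r \<and> (\<forall>x\<in>V. r x \<le> q x) \<and> (\<forall>x. x \<notin> V \<longrightarrow> r x = 0)}"
  define P :: "('b \<Rightarrow> real) \<Rightarrow> ('b \<Rightarrow> real) \<Rightarrow> bool" where "P r s \<longleftrightarrow> s \<le> r" for r s
  have restrict: "(\<lambda>x. if x \<in> V then r x else 0) \<in> S" (is "?r \<in> S")
    if "sublinear r" "\<And>x. x \<in> V \<Longrightarrow> r x \<le> q x" for r
    using that V_closed unfolding S_def sublinear_def by auto
  have "partial_order_on S (relation_of P S)"
    by (rule partial_order_on_relation_ofI) (auto simp: P_def intro: order_trans antisym)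
  moreover have "\<exists>u\<in>S. \<forall>r\<in>C. P r u" if "C \<in> Chains (relation_of P S)" for C
  proof (cases "C = {}")
    case True
    then show ?thesis
      using restrict[OF q] by auto
  next
    case False
    have CS: "r \<in> S" if "r \<in> C" for r
      using \<open>C \<in> _\<close> that by (auto simp: Chains_def relation_of_def)
    have chain: "r \<le> s \<or> s \<le> r" if "r \<in> C" "s \<in> C" for r s
      using \<open>C \<in> _\<close> that by (auto simp: Chains_def relation_of_def P_def)
    define u where "u x = (INF r\<in>C. r x)" for x
    have lower: "u x \<le> r x" if "r \<in> C" "x \<in> V" for r x
      unfolding u_def
    proof (rule cINF_lower[OF bdd_belowI2 that(1)])
      fix s
      assume "s \<in> C"
      then have "sublinear s" "s (- x) \<le> q (- x)"
        using CS that(2) V_closed by (auto simp: S_def)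
      then show "- q (- x) \<le> s x"
        using sublinear_lower[of s x] that(2) by simp
    qed
    have greatest: "a \<le> u x" if "\<And>r. r \<in> C \<Longrightarrow> a \<le> r x" for a x
      unfolding u_def using False that by (rule cINF_greatest)
    have add: "u (x + y) \<le> u x + u y" if xy: "x \<in> V" "y \<in> V" for x y
    proof -
      have "u (x + y) - s y \<le> r x" if rs: "r \<in> C" "s \<in> C" for r s
      proof -
        \<comment> \<open>In a chain the smaller of \<open>r\<close> and \<open>s\<close> can
          replace both, so that subadditivity of a single functional suffices.\<close>
        obtain v where v: "v \<in> C" "v \<le> r" "v \<le> s"
          using chain[OF rs] rs by blast
        have "u (x + y) \<le> v (x + y)"
          using lower[OF v(1)] xy V_closed by simp
        also have "\<dots> \<le> v x + v y"
          using CS[OF v(1)] xy by (auto simp: S_def intro: sublinear_add)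
        also have "\<dots> \<le> r x + s y"
          using v by (intro add_mono) (auto simp: le_fun_def)
        finally show ?thesis
          by simp
      qed
      then have "u (x + y) - s y \<le> u x" if "s \<in> C" for s
        using that by (intro greatest) auto
      then have "u (x + y) - u x \<le> u y"
        by (intro greatest) (simp add: algebra_simps)
      then show ?thesis
        by simp
    qed
    have "u (c \<odot> x) / c \<le> u x" if c: "0 < c" and x: "x \<in> V" for c x
    proof (rule greatest)
      fix r
      assume r: "r \<in> C"
      have "u (c \<odot> x) \<le> c * r x"
        using lower[OF r, of "c \<odot> x"] sublinear_scale[of r c x] CS[OF r] c x V_closed
        by (auto simp: S_def)
      then show "u (c \<odot> x) / c \<le> r x"
        using c by (simp add: field_simps)
    qed
    then have "sublinear u"
      using add by (auto simp: sublinear_def field_simps)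
    moreover have "u x \<le> q x" if "x \<in> V" for x
      using False CS lower[OF _ that] that by (force simp: S_def intro: order_trans)
    ultimately have "(\<lambda>x. if x \<in> V then u x else 0) \<in> S"
      by (rule restrict)
    moreover have "P r (\<lambda>x. if x \<in> V then u x else 0)" if "r \<in> C" for r
      using CS[OF that] lower[OF that] by (auto simp: P_def le_fun_def S_def)
    ultimately show ?thesis
      by blast
  qed
  ultimately have "\<exists>m\<in>S. \<forall>r\<in>S. P m r \<longrightarrow> r = m"
    by (rule predicate_Zorn)
  then obtain m where m: "m \<in> S" "\<And>r. r \<in> S \<Longrightarrow> r \<le> m \<Longrightarrow> r = m"
    by (auto simp: P_def)
  have "r x = m x" if r: "sublinear r" "\<And>y. y \<in> V \<Longrightarrow> r y \<le> m y" and x: "x \<in> V" for r x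
  proof -
    have "(\<lambda>x. if x \<in> V then r x else 0) \<in> S"
      using m(1) by (intro restrict r) (auto simp: S_def intro: order_trans r)
    then have "(\<lambda>x. if x \<in> V then r x else 0) = m"
      by (rule m(2)) (use m(1) r(2) in \<open>auto simp: le_fun_def S_def\<close>)
    from fun_cong[OF this, of x] x show ?thesis
      by simp
  qed
  with m(1) show ?thesis
    by (intro that[of m]) (simp_all add: S_def)
qed

text \<open>A minimal sublinear functional is linear. Taking it below \<open>lowering q v\<close>
  instead of below \<open>q\<close> also forces the value at \<open>v\<close>: the parameter
  \<open>1\<close> at the point \<open>- v\<close> gives \<open>L (- v) \<le> q 0 - q v\<close>,
  hence \<open>q v \<le> L v\<close>.\<close>

theorem Hahn_Banach:
  assumes q: "sublinear q" and v: "v \<in> V"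
  obtains L where "\<And>x y. x \<in> V \<Longrightarrow> y \<in> V \<Longrightarrow> L (x + y) = L x + L y"
    "\<And>c x. x \<in> V \<Longrightarrow> L (c \<odot> x) = c * L x"
    "\<And>x. x \<in> V \<Longrightarrow> L x \<le> q x" "L v = q v"
proof -
  have q_v: "lowering q v x \<le> q x" if "x \<in> V" for x
    using lowering_le[OF q that v, of 0] by simp
  obtain L where L: "sublinear L" "\<And>x. x \<in> V \<Longrightarrow> L x \<le> lowering q v x"
    "\<And>r x. sublinear r \<Longrightarrow> (\<And>y. y \<in> V \<Longrightarrow> r y \<le> L y) \<Longrightarrow> x \<in> V \<Longrightarrow> r x = L x"
    using exists_minimal_sublinear[OF sublinear_lowering[OF q v]] by blast
  have add: "L (x + y) = L x + L y" if x: "x \<in> V" and y: "y \<in> V" for x y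
  proof (rule antisym)
    \<comment> \<open>By minimality \<open>L\<close> coincides with its own lowering, and the
      parameter \<open>1\<close> in the infimum then yields superadditivity.\<close>
    have "lowering L y z \<le> L z" if "z \<in> V" for z
      using lowering_le[OF L(1) that y, of 0] by simp
    then have "L x = lowering L y x"
      using L(3)[OF sublinear_lowering[OF L(1) y] _ x] by simp
    also have "\<dots> \<le> L (x + y) - L y"
      using lowering_le[OF L(1) x y, of 1] by simp
    finally show "L x + L y \<le> L (x + y)"
      by simp
  qed (rule sublinear_add[OF L(1) x y])
  have neg: "L (- x) = - L x" if "x \<in> V" for x
    using add[of x "- x"] that V_closed sublinear_zero[OF L(1)] by simp
  have "L (c \<odot> x) = c * L x" if x: "x \<in> V" for c x
  proof (cases c "0::real" rule: linorder_cases)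
    case less
    then have "L (c \<odot> x) = - L ((- c) \<odot> x)"
      using neg[of "(- c) \<odot> x"] x V_closed by simp
    then show ?thesis
      using sublinear_scale[OF L(1) _ x, of "- c"] less by simp
  qed (use sublinear_scale[OF L(1) _ x] sublinear_zero[OF L(1)] in auto)
  moreover have le: "L x \<le> q x" if "x \<in> V" for x
    using L(2)[OF that] q_v[OF that] by simp
  moreover have "L v = q v"
  proof (rule antisym[OF le[OF v]])
    have "L (- v) \<le> q (- v + 1 \<odot> v) - 1 * q v"
      using L(2)[of "- v"] lowering_le[OF q _ v, of "- v" 1] v V_closed by simp
    then show "q v \<le> L v"
      using neg[OF v] sublinear_zero[OF q] by simp
  qed
  ultimately show ?thesis
    using add that by blast
qed

end

section \<open>Strong measurability, \<open>L\<^sup>p\<close> functions and their classes\<close>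

lemma strongly_measurable_add:
  assumes "strongly_measurable N f" "strongly_measurable N g"
  shows "strongly_measurable N (\<lambda>w. f w + g w)"
proof -
  obtain s s' where s: "\<And>i. simple_function N (s i)" "\<And>w. w \<in> space N \<Longrightarrow> (\<lambda>i. s i w) \<longlonglongrightarrow> f w"
    and s': "\<And>i. simple_function N (s' i)" "\<And>w. w \<in> space N \<Longrightarrow> (\<lambda>i. s' i w) \<longlonglongrightarrow> g w"
    using assms unfolding strongly_measurable_def by metis
  then show ?thesis
    unfolding strongly_measurable_def
    by (intro exI[of _ "\<lambda>i w. s i w + s' i w"])
      (auto intro: tendsto_add simple_function_compose2[where h="(+)"])
qed

lemma strongly_measurable_scaleR:
  assumes "strongly_measurable N f"
  shows "strongly_measurable N (\<lambda>w. c *\<^sub>R f w)"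
proof -
  obtain s where s: "\<And>i. simple_function N (s i)" "\<And>w. w \<in> space N \<Longrightarrow> (\<lambda>i. s i w) \<longlonglongrightarrow> f w"
    using assms unfolding strongly_measurable_def by metis
  then show ?thesis
    unfolding strongly_measurable_def
    by (intro exI[of _ "\<lambda>i w. c *\<^sub>R s i w"])
      (auto intro: tendsto_scaleR simple_function_compose1[where g="(*\<^sub>R) c"])
qed

lemma strongly_measurable_zero: "strongly_measurable N (\<lambda>w. 0)"
  unfolding strongly_measurable_def by (intro exI[of _ "\<lambda>i w. 0"]) auto

text \<open>The norms of the simple approximants are real simple functions converging pointwise to
  the norm of \<open>f\<close>, so no separability of the value space enters.\<close>

lemma borel_measurable_norm_strongly_measurable:
  assumes "strongly_measurable N f"
  shows "(\<lambda>w. norm (f w)) \<in> borel_measurable N"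
proof -
  obtain s where s: "\<And>i. simple_function N (s i)" "\<And>w. w \<in> space N \<Longrightarrow> (\<lambda>i. s i w) \<longlonglongrightarrow> f w"
    using assms unfolding strongly_measurable_def by metis
  show ?thesis
  proof (rule borel_measurable_LIMSEQ_real)
    show "(\<lambda>i. norm (s i w)) \<longlonglongrightarrow> norm (f w)" if "w \<in> space N" for w
      using s(2)[OF that] by (rule tendsto_norm)
    show "(\<lambda>w. norm (s i w)) \<in> borel_measurable N" for i
      using simple_function_compose1[OF s(1), of norm i] by (rule borel_measurable_simple_function)
  qed
qed

text \<open>Bounding \<open>a + b\<close> by \<open>2 * max a b\<close> gives a crude constant,
  enough to see that sums of \<open>L\<^sup>p\<close> functions are again in
  \<open>L\<^sup>p\<close>.\<close>

lemma powr_add_le: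
  fixes a b p :: real
  assumes "0 \<le> a" "0 \<le> b" "0 \<le> p"
  shows "(a + b) powr p \<le> 2 powr p * (a powr p + b powr p)"
proof -
  have "(a + b) powr p \<le> (2 * max a b) powr p"
    using assms by (intro powr_mono2) auto
  also have "\<dots> = 2 powr p * max a b powr p"
    using assms by (simp add: powr_mult)
  also have "\<dots> \<le> 2 powr p * (a powr p + b powr p)"
    by (intro mult_left_mono) (auto simp: max_def)
  finally show ?thesis .
qed

lemma Lp_fun_add:
  assumes f: "f \<in> Lp_fun p M N" and g: "g \<in> Lp_fun p M N" and p: "0 \<le> p"
  shows "(\<lambda>w. f w + g w) \<in> Lp_fun p M N"
proof -
  have M: "strongly_measurable M (\<lambda>w. f w + g w)"
    using f g by (intro strongly_measurable_add) (auto simp: Lp_fun_def bochner_integrable_def)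
  note [measurable] = borel_measurable_norm_strongly_measurable[OF M]
  have "integrable M (\<lambda>w. norm (f w + g w))"
  proof (rule Bochner_Integration.integrable_bound)
    show "integrable M (\<lambda>w. norm (f w) + norm (g w))"
      using f g by (auto simp: Lp_fun_def bochner_integrable_def)
  qed (auto intro: norm_triangle_ineq)
  moreover have "integrable M (\<lambda>w. norm (f w + g w) powr p)"
  proof (rule Bochner_Integration.integrable_bound)
    show "integrable M (\<lambda>w. 2 powr p * (norm (f w) powr p + norm (g w) powr p))"
      using f g by (auto simp: Lp_fun_def)
    have "norm (f w + g w) powr p \<le> 2 powr p * (norm (f w) powr p + norm (g w) powr p)" for w
    proof (rule order_trans[OF _ powr_add_le])
      show "norm (f w + g w) powr p \<le> (norm (f w) + norm (g w)) powr p"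
        using p by (intro powr_mono2) (auto intro: norm_triangle_ineq)
    qed (use p in auto)
    then show "AE w in M. norm (norm (f w + g w) powr p)
        \<le> norm (2 powr p * (norm (f w) powr p + norm (g w) powr p))"
      by simp
  qed measurable
  moreover have "strongly_measurable N (\<lambda>w. f w + g w)"
    using f g by (intro strongly_measurable_add) (auto simp: Lp_fun_def)
  ultimately show ?thesis
    using M by (simp add: Lp_fun_def bochner_integrable_def)
qed

lemma Lp_fun_scaleR:
  assumes "f \<in> Lp_fun p M N"
  shows "(\<lambda>w. c *\<^sub>R f w) \<in> Lp_fun p M N"
  using assms
  by (auto simp: Lp_fun_def bochner_integrable_def powr_mult intro: strongly_measurable_scaleR)

lemma Lp_fun_zero: "(\<lambda>w. 0) \<in> Lp_fun p M N"
  by (simp add: Lp_fun_def bochner_integrable_def strongly_measurable_zero)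

lemma mem_Lp_class_self: "f \<in> Lp_fun p M N \<Longrightarrow> f \<in> Lp_class p M f"
  by (simp add: Lp_class_def Lp_fun_def bochner_integrable_def)

lemma Lp_class_eq_iff:
  assumes "f \<in> Lp_fun p M N" "g \<in> Lp_fun p M N"
  shows "Lp_class p M f = Lp_class p M g \<longleftrightarrow> (AE w in M. f w = g w)"
proof
  assume "Lp_class p M f = Lp_class p M g"
  then have "f \<in> Lp_class p M g"
    using mem_Lp_class_self[OF assms(1)] by simp
  then show "AE w in M. f w = g w"
    by (simp add: Lp_class_def)
next
  assume *: "AE w in M. f w = g w"
  have "(AE w in M. h w = f w) \<longleftrightarrow> (AE w in M. h w = g w)" for h
  proof
    assume "AE w in M. h w = f w"
    with * show "AE w in M. h w = g w" by eventually_elim simp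
  next
    assume "AE w in M. h w = g w"
    with * show "AE w in M. h w = f w" by eventually_elim simp
  qed
  then show "Lp_class p M f = Lp_class p M g"
    by (simp add: Lp_class_def)
qed

text \<open>The representative picked by \<open>SOME\<close> equals \<open>f\<close> almost
  everywhere, hence has the same integral.\<close>

lemma Lp_norm_Lp_class:
  assumes f: "f \<in> Lp_fun p M N"
  shows "Lp_norm p M (Lp_class p M f) = (\<integral>w. norm (f w) powr p \<partial>M) powr (1 / p)"
proof -
  define g where "g = (SOME g. g \<in> Lp_class p M f)"
  have g: "g \<in> Lp_class p M f"
    unfolding g_def using mem_Lp_class_self[OF f]
    by (rule someI[where P="\<lambda>g. g \<in> Lp_class p M f"])
  have "(\<integral>w. norm (g w) powr p \<partial>M) = (\<integral>w. norm (f w) powr p \<partial>M)"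
  proof (rule integral_cong_AE)
    have "AE w in M. g w = f w"
      using g by (simp add: Lp_class_def)
    then show "AE w in M. norm (g w) powr p = norm (f w) powr p"
      by eventually_elim simp
  qed (use f g in \<open>auto simp: Lp_class_def Lp_fun_def intro: borel_measurable_integrable\<close>)
  then show ?thesis
    by (simp add: Lp_norm_def g_def)
qed

section \<open>Separation of classes by bounded functionals\<close>

text \<open>A form of Jensen's inequality with the constant \<open>2\<close>. With \<open>E\<close>
  the expectation of \<open>f w powr p\<close> and \<open>K = E powr (1 / p)\<close>, the pointwise
  bound \<open>f w \<le> K + K / E * f w powr p\<close> integrates to \<open>2 * K\<close>. If
  \<open>E = 0\<close>, then \<open>f\<close> vanishes almost everywhere.\<close>

lemma (in prob_space) expectation_le_Lp:
  fixes f :: "'a \<Rightarrow> real"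
  assumes f: "\<And>w. 0 \<le> f w" "integrable M f" "integrable M (\<lambda>w. f w powr p)" and p: "1 \<le> p"
  shows "expectation f \<le> 2 * expectation (\<lambda>w. f w powr p) powr (1 / p)"
proof (cases "expectation (\<lambda>w. f w powr p) = 0")
  case True
  then have "AE w in M. f w powr p = 0"
    using f(3) by (subst (asm) integral_nonneg_eq_0_iff_AE) auto
  then have "AE w in M. f w = 0"
    by auto
  then have "expectation f = expectation (\<lambda>w. 0)"
    using f(2) by (intro integral_cong_AE) auto
  with True show ?thesis
    by simp
next
  case False
  define E where "E = expectation (\<lambda>w. f w powr p)"
  have "0 \<le> E"
    unfolding E_def by (intro Bochner_Integration.integral_nonneg) simp
  with False have "0 < E"
    unfolding E_def by linarith
  define K where "K = E powr (1 / p)"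
  have K: "0 < K" "K powr p = E"
    using \<open>0 < E\<close> p by (simp_all add: K_def powr_powr)
  have "f w \<le> K + K / E * f w powr p" for w
  proof (cases "f w \<le> K")
    case True
    moreover have "0 \<le> K / E * f w powr p"
      using K \<open>0 < E\<close> by simp
    ultimately show ?thesis
      by simp
  next
    case False
    \<comment> \<open>Here \<open>f w / K > 1\<close>, so raising it to the power
      \<open>p \<ge> 1\<close> does not decrease it.\<close>
    then have "(f w / K) powr 1 \<le> (f w / K) powr p"
      using p K by (intro powr_mono) auto
    then have "f w / K \<le> f w powr p / E"
      using K f(1)[of w] False by (simp add: powr_divide)
    then have "f w \<le> K / E * f w powr p"
      using K \<open>0 < E\<close> by (simp add: field_simps)
    then show ?thesis
      using K by simp
  qed
  then have "expectation f \<le> expectation (\<lambda>w. K + K / E * f w powr p)"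
    using f by (intro integral_mono) auto
  also have "\<dots> = K + K / E * E"
    using f by (simp add: E_def prob_space)
  also have "\<dots> = 2 * K"
    using \<open>0 < E\<close> by simp
  finally show ?thesis
    by (simp add: K_def E_def)
qed

text \<open>The \<open>L\<^sup>1\<close> seminorm serves as the dominating functional in Hahn-Banach: unlike the \<open>L\<^sup>p\<close> seminorm
  it needs no Minkowski inequality, and it already separates classes.\<close>

lemma (in prob_space) Lp_dual_separates:
  fixes u v :: "('a \<Rightarrow> 'b::real_normed_vector) set"
  assumes u: "u \<in> Lp p M N" and v: "v \<in> Lp p M N" and "u \<noteq> v" and p: "1 \<le> p"
  obtains L where "L \<in> Lp_dual p M N" "L u \<noteq> L v"
proof -
  define V where "V = (Lp_fun p M N :: ('a \<Rightarrow> 'b) set)"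
  define q where "q h = expectation (\<lambda>w. norm (h w))" for h :: "'a \<Rightarrow> 'b"
  have int: "integrable M (\<lambda>w. norm (h w))" if "h \<in> V" for h
    using that by (simp add: V_def Lp_fun_def bochner_integrable_def)
  interpret fs: vector_space "\<lambda>c (h :: 'a \<Rightarrow> 'b) w. c *\<^sub>R h w"
    by unfold_locales (auto simp: fun_eq_iff scaleR_add_right scaleR_add_left)
  have V: "fs.subspace V"
    using p by (auto simp: fs.subspace_def V_def zero_fun_def plus_fun_def
        intro: Lp_fun_zero Lp_fun_add Lp_fun_scaleR)
  interpret fs: real_subspace "\<lambda>c (h :: 'a \<Rightarrow> 'b) w. c *\<^sub>R h w" V
    using V by unfold_locales
  have "q (h + k) \<le> q h + q k" if "h \<in> V" "k \<in> V" for h k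
  proof -
    have "q (h + k) \<le> expectation (\<lambda>w. norm (h w) + norm (k w))"
      unfolding q_def
    proof (rule integral_mono)
      show "integrable M (\<lambda>w. norm ((h + k) w))"
        using that by (intro int fs.V_closed)
      show "integrable M (\<lambda>w. norm (h w) + norm (k w))"
        using that by (intro Bochner_Integration.integrable_add int)
    qed (simp add: norm_triangle_ineq)
    also have "\<dots> = q h + q k"
      using that by (simp add: q_def int)
    finally show ?thesis .
  qed
  moreover have q_scale: "q (\<lambda>w. c *\<^sub>R h w) = \<bar>c\<bar> * q h" for c h
    by (simp add: q_def)
  ultimately have "fs.sublinear q"
    by (simp add: fs.sublinear_def)
  obtain f g where fg: "f \<in> V" "g \<in> V" "u = Lp_class p M f" "v = Lp_class p M g"
    using u v by (auto simp: Lp_def V_def)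
  \<comment> \<open>The functional is made to attain \<open>q\<close> at \<open>f - g\<close>, where
    \<open>q\<close> is nonzero because \<open>f\<close> and \<open>g\<close> represent different
    classes.\<close>
  obtain l where l_add: "\<And>h k. h \<in> V \<Longrightarrow> k \<in> V \<Longrightarrow> l (h + k) = l h + l k"
    and l_scale: "\<And>c h. h \<in> V \<Longrightarrow> l (\<lambda>w. c *\<^sub>R h w) = c * l h"
    and l_le: "\<And>h. h \<in> V \<Longrightarrow> l h \<le> q h" and l_eq: "l (f - g) = q (f - g)"
    using fs.Hahn_Banach[OF \<open>fs.sublinear q\<close> fs.V_closed(5)[OF fg(1,2)]] by blast
  have l_abs: "\<bar>l h\<bar> \<le> q h" if "h \<in> V" for h
    using l_le[OF that] l_le[OF fs.V_closed(3)[OF that, of "-1"]] l_scale[OF that, of "-1"]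
      q_scale[of "-1" h] by simp
  have l_diff: "l (h - k) = l h - l k" if "h \<in> V" "k \<in> V" for h k
    using l_add[of "h - k" k] fs.V_closed(5)[OF that] that by simp
  \<comment> \<open>To pass from functions to classes a representative is chosen. The choice is
    immaterial: two representatives differ by a function of \<open>q\<close>-value \<open>0\<close>,
    on which \<open>l\<close> vanishes.\<close>
  define L where "L c = l (SOME h. h \<in> V \<and> Lp_class p M h = c)" for c
  have L: "L (Lp_class p M h) = l h" if h: "h \<in> V" for h
  proof -
    define k where "k = (SOME k. k \<in> V \<and> Lp_class p M k = Lp_class p M h)"
    have k: "k \<in> V \<and> Lp_class p M k = Lp_class p M h"
      unfolding k_def by (rule someI[of _ h]) (use h in simp)
    have kh: "k - h \<in> V"
      using k h by (intro fs.V_closed) auto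
    have "AE w in M. k w = h w"
      using k h Lp_class_eq_iff[of k p M N h] by (simp add: V_def)
    then have "AE w in M. norm ((k - h) w) = 0"
      by eventually_elim simp
    then have "q (k - h) = expectation (\<lambda>w. 0)"
      unfolding q_def by (intro integral_cong_AE borel_measurable_integrable[OF int[OF kh]]) simp_all
    then have "l k = l h"
      using l_abs[OF kh] l_diff k h by simp
    then show ?thesis
      by (simp add: L_def k_def)
  qed
  have "L \<in> Lp_dual p M N"
    unfolding Lp_dual_def mem_Collect_eq V_def[symmetric]
  proof (intro conjI ballI allI)
    fix h k assume "h \<in> V" "k \<in> V"
    then have "L (Lp_class p M (h + k)) = L (Lp_class p M h) + L (Lp_class p M k)"
      by (simp add: L l_add fs.V_closed)
    then show "L (Lp_class p M (\<lambda>w. h w + k w)) = L (Lp_class p M h) + L (Lp_class p M k)"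
      unfolding plus_fun_def .
  next
    fix c h assume "h \<in> V"
    then show "L (Lp_class p M (\<lambda>w. c *\<^sub>R h w)) = c * L (Lp_class p M h)"
      by (simp add: L l_scale fs.V_closed)
  next
    have "\<bar>L c\<bar> \<le> 2 * Lp_norm p M c" if c: "c \<in> Lp p M N" for c
    proof -
      obtain h where h: "h \<in> V" "c = Lp_class p M h"
        using c by (auto simp: Lp_def V_def)
      have "\<bar>L c\<bar> \<le> q h"
        using h by (simp add: L l_abs)
      also have "\<dots> \<le> 2 * expectation (\<lambda>w. norm (h w) powr p) powr (1 / p)"
        unfolding q_def using h int[OF h(1)] p
        by (intro expectation_le_Lp) (auto simp: V_def Lp_fun_def)
      also have "\<dots> = 2 * Lp_norm p M c"
        using h Lp_norm_Lp_class[of h p M N] by (simp add: V_def)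
      finally show ?thesis .
    qed
    then show "\<exists>C. \<forall>c\<in>Lp p M N. \<bar>L c\<bar> \<le> C * Lp_norm p M c"
      by blast
  qed
  moreover have "L u \<noteq> L v"
  proof
    assume "L u = L v"
    then have "q (f - g) = 0"
      using fg l_eq by (simp add: L l_diff)
    then have "AE w in M. norm ((f - g) w) = 0"
      unfolding q_def using int[OF fs.V_closed(5)[OF fg(1,2)]]
      by (subst (asm) integral_nonneg_eq_0_iff_AE) auto
    then have "AE w in M. f w = g w"
      by simp
    then show False
      using fg \<open>u \<noteq> v\<close> Lp_class_eq_iff unfolding V_def by blast
  qed
  ultimately show ?thesis
    by (rule that)
qed

text \<open>Every \<open>v \<noteq> u\<close> has the subbasic neighbourhood of all \<open>c\<close>
  with \<open>L c \<noteq> L u\<close>, where \<open>L\<close> separates \<open>u\<close> from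
  \<open>v\<close>; it omits \<open>u\<close>.\<close>

lemma (in prob_space) openin_weak_topology_delete:
  assumes u: "u \<in> Lp p M N" and p: "1 \<le> p"
  shows "openin (weak_topology p M N) (Lp p M N - {u})"
proof -
  have "\<exists>U. openin (weak_topology p M N) U \<and> v \<in> U \<and> U \<subseteq> Lp p M N - {u}"
    if v: "v \<in> Lp p M N - {u}" for v
  proof -
    obtain L where L: "L \<in> Lp_dual p M N" "L u \<noteq> L v"
      using Lp_dual_separates[OF u _ _ p, of v] v by auto
    have "open (- {L u})"
      by (simp add: open_Compl)
    then have "openin (weak_topology p M N) {c \<in> Lp p M N. L c \<in> - {L u}}"
      unfolding weak_topology_def using L(1) by (intro topology_generated_by_Basis) blast
    then show ?thesis
      using L v by (intro exI[of _ "{c \<in> Lp p M N. L c \<in> - {L u}}"]) auto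
  qed
  then show ?thesis
    by (subst openin_subopen) blast
qed

section \<open>Complete trajectories and the attractor\<close>

lemma complete_trajectory_mem_weakly_attracting:
  assumes "prob_space M" "1 \<le> p"
    and attr: "pullback_weakly_attracting p M F \<Phi> \<D> K" and K: "K t \<subseteq> Lp p M (F t)"
    and \<phi>: "complete_trajectory p M F \<Phi> \<phi>" "(\<lambda>s. {\<phi> s}) \<in> \<D>"
  shows "\<phi> t \<in> K t"
proof (rule ccontr)
  assume "\<phi> t \<notin> K t"
  note traj = \<phi>(1)[unfolded complete_trajectory_def]
  define W where "W = Lp p M (F t) - {\<phi> t}"
  have "openin (weak_topology p M (F t)) W"
    unfolding W_def
  proof (rule prob_space.openin_weak_topology_delete[OF assms(1) _ assms(2)])
    show "\<phi> t \<in> Lp p M (F t)"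
      by (rule conjunct1[OF traj, rule_format])
  qed
  then have "weak_neighborhood p M (F t) (K t) W"
    using \<open>\<phi> t \<notin> K t\<close> K unfolding weak_neighborhood_def W_def by blast
  with attr[unfolded pullback_weakly_attracting_def, rule_format, OF \<phi>(2)]
  obtain T where T: "T > 0" "\<And>s. T \<le> s \<Longrightarrow> \<Phi> s (t - s) ` {\<phi> (t - s)} \<subseteq> W"
    by metis
  \<comment> \<open>The trajectory equation is stated for strictly earlier times only, which is why
    \<open>T > 0\<close> matters.\<close>
  have "\<phi> t = \<Phi> (t - (t - T)) (t - T) (\<phi> (t - T))"
  proof -
    have "t - T < t"
      using T(1) by simp
    then show ?thesis
      by (rule conjunct2[OF traj, rule_format])
  qed
  moreover have "\<Phi> T (t - T) (\<phi> (t - T)) \<in> W"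
    using T(2)[of T] by simp
  ultimately show False
    by (simp add: W_def)
qed

text \<open>Invariance with time step \<open>1\<close> and dependent choice give points
  \<open>X n\<close> of \<open>A (t - real n)\<close>, each mapped to its predecessor. The
  trajectory at time \<open>s\<close> is the forward image of any \<open>X n\<close> with
  \<open>t - real n \<le> s\<close>; the cocycle law shows that the choice of \<open>n\<close> does
  not matter.\<close>

lemma complete_trajectory_through:
  assumes rds: "mean_rds p M F \<Phi>" and inv: "invariant_family \<Phi> A"
    and A: "\<And>s. A s \<subseteq> Lp p M (F s)" and x: "x \<in> A t"
  obtains \<phi> where "complete_trajectory p M F \<Phi> \<phi>" "\<And>s. \<phi> s \<in> A s" "\<phi> t = x"
proof -
  have \<Phi>_0: "\<Phi> 0 s u = u" if "u \<in> A s" for s u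
    by (rule rds[unfolded mean_rds_def, THEN conjunct2, THEN conjunct1, rule_format])
      (use A that in blast)
  have \<Phi>_add: "\<Phi> (r + s) \<tau> u = \<Phi> r (s + \<tau>) (\<Phi> s \<tau> u)" if "u \<in> A \<tau>" "0 \<le> r" "0 \<le> s" for r s \<tau> u
    by (rule rds[unfolded mean_rds_def, THEN conjunct2, THEN conjunct2, rule_format])
      (use A that in auto)
  have \<Phi>_A: "\<Phi> r s u \<in> A (r + s)" if "u \<in> A s" "0 \<le> r" for r s u
  proof -
    have "A (r + s) = \<Phi> r (r + s - r) ` A (r + s - r)"
      by (rule inv[unfolded invariant_family_def, rule_format, OF that(2)])
    then show ?thesis
      using that by simp
  qed
  have "\<exists>y. y \<in> A (t - real (Suc n)) \<and> \<Phi> 1 (t - real (Suc n)) y = z" if "z \<in> A (t - real n)" for n z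
  proof -
    have "A (t - real n) = \<Phi> 1 (t - real n - 1) ` A (t - real n - 1)"
      by (rule inv[unfolded invariant_family_def, rule_format, OF zero_le_one])
    moreover have "t - real n - 1 = t - real (Suc n)"
      by simp
    ultimately show ?thesis
      using that by auto
  qed
  \<comment> \<open>The clause for \<open>n = 0\<close> pins the start of the chosen sequence to
    \<open>x\<close>.\<close>
  then have "\<exists>X. \<forall>n. (X n \<in> A (t - real n) \<and> (n = 0 \<longrightarrow> X n = x)) \<and>
      \<Phi> 1 (t - real (Suc n)) (X (Suc n)) = X n"
    using x by (intro dependent_nat_choice[where P="\<lambda>n y. y \<in> A (t - real n) \<and> (n = 0 \<longrightarrow> y = x)"
          and Q="\<lambda>n y y'. \<Phi> 1 (t - real (Suc n)) y' = y"]) auto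
  then obtain X where X: "\<And>n. X n \<in> A (t - real n)" "X 0 = x"
    "\<And>n. \<Phi> 1 (t - real (Suc n)) (X (Suc n)) = X n"
    by blast
  have X_shift: "\<Phi> (real k) (t - real (n + k)) (X (n + k)) = X n" for n k
  proof (induction k)
    case 0
    then show ?case
      using \<Phi>_0 X(1) by simp
  next
    case (Suc k)
    \<comment> \<open>One unit step leads from \<open>X (Suc (n + k))\<close> to
      \<open>X (n + k)\<close>; the induction hypothesis covers the other \<open>k\<close>
      units.\<close>
    have "\<Phi> (real k + 1) (t - real (Suc (n + k))) (X (Suc (n + k))) =
        \<Phi> (real k) (1 + (t - real (Suc (n + k)))) (X (n + k))"
      using \<Phi>_add[OF X(1), of "real k" 1 "Suc (n + k)"] X(3)[of "n + k"] by simp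
    moreover have "1 + (t - real (Suc (n + k))) = t - real (n + k)" "real k + 1 = real (Suc k)"
      by simp_all
    ultimately show ?case
      using Suc by (metis add_Suc_right)
  qed
  \<comment> \<open>The least admissible index is used. For \<open>s \<ge> t\<close> the truncation
    by \<open>nat\<close> gives \<open>n = 0\<close>, so there the trajectory is the forward orbit
    of \<open>x\<close>.\<close>
  define \<phi> where "\<phi> s = (let n = nat \<lceil>t - s\<rceil> in \<Phi> (s - (t - real n)) (t - real n) (X n))" for s
  have \<phi>: "\<phi> s = \<Phi> (s - (t - real n)) (t - real n) (X n)" if "t - s \<le> real n" for s n
  proof -
    define m where "m = nat \<lceil>t - s\<rceil>"
    have m: "t - s \<le> real m" "m \<le> n"
      using that unfolding m_def by linarith+
    \<comment> \<open>Started at the larger index \<open>n\<close>, the flow passes through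
      \<open>X m\<close> after \<open>n - m\<close> units and then continues as in the
      definition.\<close>
    have "\<Phi> ((s - (t - real m)) + real (n - m)) (t - real n) (X n) =
        \<Phi> (s - (t - real m)) (real (n - m) + (t - real n)) (\<Phi> (real (n - m)) (t - real n) (X n))"
      using m by (intro \<Phi>_add X) auto
    moreover have "(s - (t - real m)) + real (n - m) = s - (t - real n)"
      "real (n - m) + (t - real n) = t - real m"
      using m by (simp_all add: of_nat_diff)
    moreover have "\<Phi> (real (n - m)) (t - real n) (X n) = X m"
      using X_shift[of "n - m" m] m by simp
    ultimately show ?thesis
      unfolding \<phi>_def Let_def m_def[symmetric] by metis
  qed
  have \<phi>_A: "\<phi> s \<in> A s" for s
  proof -
    obtain n where n: "t - s \<le> real n"
      using real_arch_simple by blast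
    then show ?thesis
      using \<Phi>_A[OF X(1), of "s - (t - real n)" n] by (simp add: \<phi>)
  qed
  have "\<phi> s' = \<Phi> (s' - s) s (\<phi> s)" if "s < s'" for s s'
  proof -
    \<comment> \<open>An index admissible for \<open>s\<close> is admissible for the later time
      \<open>s'\<close>, so both values come from the same \<open>X n\<close>.\<close>
    obtain n where n: "t - s \<le> real n"
      using real_arch_simple by blast
    then have "\<Phi> ((s' - s) + (s - (t - real n))) (t - real n) (X n) =
        \<Phi> (s' - s) ((s - (t - real n)) + (t - real n)) (\<Phi> (s - (t - real n)) (t - real n) (X n))"
      using that by (intro \<Phi>_add X) auto
    moreover have "(s' - s) + (s - (t - real n)) = s' - (t - real n)"
      by simp
    ultimately show ?thesis
      using \<phi>[of s n] \<phi>[of s' n] n that by simp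
  qed
  then have "complete_trajectory p M F \<Phi> \<phi>"
    unfolding complete_trajectory_def by (intro conjI allI impI subsetD[OF A \<phi>_A])
  moreover have "\<phi> t = x"
    using \<phi>[of t 0] \<Phi>_0[of "X 0" t] X(1)[of 0] X(2) by simp
  ultimately show ?thesis
    using \<phi>_A that by blast
qed

lemma bounded_family_singletons:
  assumes "bounded_family p M F A" "\<And>s. \<phi> s \<in> A s"
  shows "bounded_family p M F (\<lambda>s. {\<phi> s})"
  using assms unfolding bounded_family_def Lp_family_def Lp_bounded_def by blast

text \<open>Trajectories in \<open>\<D>\<close> lie in the attractor by attraction alone. The
  reverse inclusion constructs a bounded trajectory inside \<open>A\<close>; that its singletons
  form a member of \<open>\<D>\<close> is supplied by \<open>inclusion_closed \<D>\<close>. If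
  \<open>\<D>\<close> contains every bounded family, membership is automatic for bounded
  trajectories and drops out of the description.\<close>

theorem lemma17:
  fixes M :: "'w measure"
    and F :: "real \<Rightarrow> 'w measure"
    and p :: real
    and \<Phi> :: "real \<Rightarrow> real \<Rightarrow> ('w \<Rightarrow> 'x::banach) set \<Rightarrow> ('w \<Rightarrow> 'x) set"
    and \<D> :: "('w, 'x) Lp_family set"
    and A :: "('w, 'x) Lp_family"
  assumes "complete_filtered_prob_space M F"
    and "1 < p"
    and "\<forall>D\<in>\<D>. Lp_family p M F D"
    and "mean_rds p M F \<Phi>"
    and "weak_pullback_mean_random_attractor p M F \<Phi> \<D> A"
    and "invariant_family \<Phi> A"
    and "bounded_family p M F A"
  shows "(\<forall>t. {\<phi> t | \<phi>. (\<lambda>s. {\<phi> s}) \<in> \<D> \<and> complete_trajectory p M F \<Phi> \<phi> \<and>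
                bounded_family p M F (\<lambda>s. {\<phi> s})} \<subseteq> A t) \<and>
    (inclusion_closed \<D> \<longrightarrow>
      (\<forall>t. A t = {\<phi> t | \<phi>. (\<lambda>s. {\<phi> s}) \<in> \<D> \<and> complete_trajectory p M F \<Phi> \<phi> \<and>
                bounded_family p M F (\<lambda>s. {\<phi> s})})) \<and>
    ((\<forall>D. bounded_family p M F D \<longrightarrow> D \<in> \<D>) \<longrightarrow>
      (\<forall>t. A t = {\<phi> t | \<phi>. complete_trajectory p M F \<Phi> \<phi> \<and>
                bounded_family p M F (\<lambda>s. {\<phi> s})}))"
proof -
  interpret complete_filtered_prob_space M F
    by fact
  have p: "1 \<le> p"
    using \<open>1 < p\<close> by simp
  have attr: "pullback_weakly_attracting p M F \<Phi> \<D> A"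
    using assms(5) by (simp add: weak_pullback_mean_random_attractor_def)
  have "A \<in> \<D>"
    using assms(5) by (simp add: weak_pullback_mean_random_attractor_def)
  have A: "A s \<subseteq> Lp p M (F s)" for s
    using assms(7) by (simp add: bounded_family_def Lp_family_def)
  have mem: "\<phi> t \<in> A t" if "complete_trajectory p M F \<Phi> \<phi>" "(\<lambda>s. {\<phi> s}) \<in> \<D>" for \<phi> t
    using complete_trajectory_mem_weakly_attracting[OF prob_space_axioms p attr A that] .
  have ex: "\<exists>\<phi>. x = \<phi> t \<and> (\<forall>s. \<phi> s \<in> A s) \<and> complete_trajectory p M F \<Phi> \<phi> \<and>
      bounded_family p M F (\<lambda>s. {\<phi> s})" if x: "x \<in> A t" for x t
  proof -
    obtain \<phi> where "complete_trajectory p M F \<Phi> \<phi>" "\<And>s. \<phi> s \<in> A s" "\<phi> t = x"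
      using complete_trajectory_through[OF assms(4,6) A x] by blast
    then show ?thesis
      using bounded_family_singletons[OF assms(7)] by blast
  qed
  have sub: "(\<lambda>s. {\<phi> s}) \<in> \<D>" if "inclusion_closed \<D>" "\<And>s. \<phi> s \<in> A s" for \<phi>
    using that \<open>A \<in> \<D>\<close> by (auto simp: inclusion_closed_def)
  show ?thesis
  proof (intro conjI allI impI subset_antisym subsetI)
    fix t x
    assume "inclusion_closed \<D>" "x \<in> A t"
    then show "x \<in> {\<phi> t | \<phi>. (\<lambda>s. {\<phi> s}) \<in> \<D> \<and> complete_trajectory p M F \<Phi> \<phi> \<and>
        bounded_family p M F (\<lambda>s. {\<phi> s})}"
      using ex[of x t] sub by blast
  next
    fix t x
    assume "x \<in> A t"
    then show "x \<in> {\<phi> t | \<phi>. complete_trajectory p M F \<Phi> \<phi> \<and> bounded_family p M F (\<lambda>s. {\<phi> s})}"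
      using ex[of x t] by blast
  \<comment> \<open>These are the inclusions into \<open>A t\<close>; in the last one, boundedness
    of the trajectory puts it in \<open>\<D>\<close>.\<close>
  qed (use mem in blast)+
qed

end
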